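(* Let $T=\langle T_\alpha:\alpha\in\omega_1\rangle$ be a tower in $\mathcal P(\omega)$ of height $\omega_1$. The group $\mathrm H^1(\mathcal D,F)$ is isomorphic to the set of gaps in $T$ modulo the equivalence relation "cohomologous", with group operation being levelwise symmetric difference.
   Context: For $X,Y\subseteq\omega$, $X\subseteq^*Y$ means $X\setminus Y$ is finite and $X=^*Y$ means $X\triangle Y$ is finite, where $\triangle$ is symmetric difference. A tower of height $\omega_1$ is a sequence $\langle T_\alpha:\alpha\in\omega_1\rangle$ of subsets of $\omega$ with $T_\beta\subseteq^*T_\alpha$ for $\beta<\alpha$. A subtower $A$ of $T$ is a tower with $A_\alpha\subseteq T_\alpha$ for each $\alpha$ and $A_\alpha\cap(T_\beta\setminus A_\beta)$ finite for all $\beta<\alpha$. A subtower $A$ of $T$ is a gap in $T$ if the pair $\langle A,B\rangle$, where $B_\alpha=T_\alpha\setminus A_\alpha$, is a Hausdorff gap; equivalently, if there is no $X\subseteq\omega$ with $X\cap T_\alpha=^*A_\alpha$ for all $\alpha\in\omega_1$. Two gaps $A,A'$ in $T$ are cohomologous if their levelwise symmetric difference, the subtower $\langle A_\alpha\triangle A'_\alpha:\alpha\in\omega_1\rangle$, is not a gap in $T$. Let $\mathcal D$ be the family of all $D\subseteq\omega$ such that for some $\alpha\in\omega_1$, $D\supseteq T_\alpha$ and $D\setminus T_\alpha$ is finite. For $D\in\mathcal D$ let $F_D=\bigoplus_D\mathbb Z/2$ be the group of finitely supported functions $D\to\mathbb Z/2$, with restriction maps $f\mapsto f\restriction D_2$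 for $D_1\supseteq D_2$. The $n$-cochains are $\mathrm C^n(\mathcal D,F)=\prod_{D_0\supseteq\dots\supseteq D_n,\ D_i\in\mathcal D}F_{D_n}$, with coboundary $$(\delta x)(D_0\supseteq\dots\supseteq D_{n+1})=\sum_{i=0}^n(-1)^i x(D_0\dots\widehat{D_i}\dots D_{n+1})+(-1)^{n+1}\,x(D_0\dots D_n)\restriction D_{n+1},$$ where $\widehat{D_i}$ means $D_i$ is omitted, and $\mathrm H^n(\mathcal D,F)$ is the $n$-th cohomology group of this cochain complex.
   Formalization: Since A△A is empty and never a gap, the set of gaps modulo "cohomologous" has no neutral element (it is empty if all T_α are empty); one class is added as neutral element, consisting of all subtowers of T that are not gaps. *)

theory Defs
  imports "HOL-Algebra.Product_Groups" "HOL-Library.Z2" "HOL-Library.Countable_Set"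
begin

section \<open>The ordinal \<open>\<omega>\<^sub>1\<close> as a type\<close>

typedef omega1 = "Field (cardSuc natLeq)"
  by (metis Field_cardSuc_not_empty equals0I natLeq_Card_order)

lemma wo_rel_cardSuc_natLeq: "wo_rel (cardSuc natLeq)"
  using cardSuc_Card_order[OF natLeq_Card_order] by (simp add: wo_rel_def card_order_on_def)

instantiation omega1 :: linorder
begin

definition less_eq_omega1 :: "omega1 \<Rightarrow> omega1 \<Rightarrow> bool" where
  "\<alpha> \<le> \<beta> \<longleftrightarrow> (Rep_omega1 \<alpha>, Rep_omega1 \<beta>) \<in> cardSuc natLeq"

definition less_omega1 :: "omega1 \<Rightarrow> omega1 \<Rightarrow> bool" where
  "\<alpha> < \<beta> \<longleftrightarrow> \<alpha> \<le> \<beta> \<and> \<not> \<beta> \<le> (\<alpha>::omega1)"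

instance
proof
  interpret wo_rel "cardSuc natLeq"
    by (simp add: wo_rel_cardSuc_natLeq)
  fix x y z :: omega1
  show "x < y \<longleftrightarrow> x \<le> y \<and> \<not> y \<le> x" by (simp add: less_omega1_def)
  show "x \<le> x"
    using REFL Rep_omega1[of x] by (auto simp: less_eq_omega1_def refl_on_def)
  show "x \<le> z" if "x \<le> y" "y \<le> z"
    using that TRANS unfolding less_eq_omega1_def by (blast dest: transD)
  show "x = y" if "x \<le> y" "y \<le> x"
    using that ANTISYM Rep_omega1_inject unfolding less_eq_omega1_def antisym_def by blast
  show "x \<le> y \<or> y \<le> x"
    using TOTALS Rep_omega1[of x] Rep_omega1[of y] unfolding less_eq_omega1_def by blast
qed

end

instance omega1 :: wellorder
proof
  fix P :: "omega1 \<Rightarrow> bool" and a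
  assume step: "\<And>x. (\<And>y. y < x \<Longrightarrow> P y) \<Longrightarrow> P x"
  have "wf (inv_image (cardSuc natLeq - Id) Rep_omega1)"
    using wo_rel.WF[OF wo_rel_cardSuc_natLeq] by (rule wf_inv_image)
  moreover have "{(x, y::omega1). x < y} \<subseteq> inv_image (cardSuc natLeq - Id) Rep_omega1"
    by (auto simp: less_omega1_def less_eq_omega1_def)
  ultimately have "wf {(x, y::omega1). x < y}" by (rule wf_subset)
  then show "P a" by (rule wf_induct_rule) (use step in blast)
qed

lemma countable_iff_ordLeq_natLeq:
  includes cardinal_syntax
  shows "countable A \<longleftrightarrow> card_of A \<le>o natLeq"
proof -
  have "countable A \<longleftrightarrow> card_of A \<le>o card_of (UNIV :: nat set)"
    by (simp add: countable_def card_of_ordLeq[symmetric])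
  also have "\<dots> \<longleftrightarrow> card_of A \<le>o natLeq"
    using card_of_nat ordLeq_ordIso_trans ordIso_symmetric by blast
  finally show ?thesis .
qed

lemma omega1_uncountable:
  includes cardinal_syntax
  shows "uncountable (UNIV :: omega1 set)"
proof
  let ?r = "cardSuc natLeq"
  assume "countable (UNIV :: omega1 set)"
  then have "countable (Rep_omega1 ` UNIV)" by (rule countable_image)
  then have "countable (Field ?r)"
    using type_definition.Rep_range[OF type_definition_omega1] by simp
  then have "card_of (Field ?r) \<le>o natLeq" by (simp add: countable_iff_ordLeq_natLeq)
  moreover have "natLeq <o card_of (Field ?r)"
    using cardSuc_greater[OF natLeq_Card_order] cardSuc_Card_order[OF natLeq_Card_order]
    by (meson card_of_Field_ordIso ordIso_symmetric ordLess_ordIso_trans)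
  ultimately show False using not_ordLess_ordLeq by blast
qed

lemma omega1_countable_below:
  includes cardinal_syntax
  shows "countable {\<beta>::omega1. \<beta> < \<alpha>}"
proof -
  let ?r = "cardSuc natLeq"
  have C: "Card_order ?r" by (simp add: cardSuc_Card_order natLeq_Card_order)
  have "card_of (underS ?r (Rep_omega1 \<alpha>)) <o ?r"
    using C Rep_omega1 by (rule card_of_underS)
  then have "card_of (underS ?r (Rep_omega1 \<alpha>)) \<le>o natLeq"
    using cardSuc_ordLeq_ordLess card_of_Card_order natLeq_Card_order by blast
  then have "countable (underS ?r (Rep_omega1 \<alpha>))" by (simp add: countable_iff_ordLeq_natLeq)
  moreover have "Rep_omega1 ` {\<beta>. \<beta> < \<alpha>} \<subseteq> underS ?r (Rep_omega1 \<alpha>)"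
    by (auto simp: underS_def less_omega1_def less_eq_omega1_def)
  ultimately have "countable (Rep_omega1 ` {\<beta>. \<beta> < \<alpha>})" by (rule countable_subset[rotated])
  then show ?thesis
    by (rule countable_image_inj_on) (simp add: Rep_omega1_inject inj_on_def)
qed


section \<open>Towers and gaps\<close>

definition almost_subset :: "nat set \<Rightarrow> nat set \<Rightarrow> bool" (infix \<open>\<subseteq>\<^sup>*\<close> 50) where
  "X \<subseteq>\<^sup>* Y \<longleftrightarrow> finite (X - Y)"

definition almost_eq :: "nat set \<Rightarrow> nat set \<Rightarrow> bool" (infix \<open>=\<^sup>*\<close> 50) where
  "X =\<^sup>* Y \<longleftrightarrow> finite (sym_diff X Y)"

definition tower :: "(omega1 \<Rightarrow> nat set) \<Rightarrow> bool" where
  "tower T \<longleftrightarrow> (\<forall>\<alpha>. \<forall>\<beta><\<alpha>. T \<beta> \<subseteq>\<^sup>* T \<alpha>)"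

definition subtower :: "(omega1 \<Rightarrow> nat set) \<Rightarrow> (omega1 \<Rightarrow> nat set) \<Rightarrow> bool" where
  "subtower T A \<longleftrightarrow> tower A \<and> (\<forall>\<alpha>. A \<alpha> \<subseteq> T \<alpha>) \<and>
     (\<forall>\<alpha>. \<forall>\<beta><\<alpha>. finite (A \<alpha> \<inter> (T \<beta> - A \<beta>)))"

text \<open>
  Towers are increasing modulo finite, not necessarily strictly, so neither are the two sides
  of a Hausdorff gap.
\<close>

definition hausdorff_gap :: "(omega1 \<Rightarrow> nat set) \<Rightarrow> (omega1 \<Rightarrow> nat set) \<Rightarrow> bool" where
  "hausdorff_gap A B \<longleftrightarrow> tower A \<and> tower B \<and> (\<forall>\<alpha> \<beta>. finite (A \<alpha> \<inter> B \<beta>)) \<and>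
     \<not> (\<exists>X. \<forall>\<alpha>. A \<alpha> \<subseteq>\<^sup>* X \<and> finite (X \<inter> B \<alpha>))"

definition gap_in :: "(omega1 \<Rightarrow> nat set) \<Rightarrow> (omega1 \<Rightarrow> nat set) \<Rightarrow> bool" where
  "gap_in T A \<longleftrightarrow> subtower T A \<and> hausdorff_gap A (\<lambda>\<alpha>. T \<alpha> - A \<alpha>)"

definition level_sym_diff ::
    "(omega1 \<Rightarrow> nat set) \<Rightarrow> (omega1 \<Rightarrow> nat set) \<Rightarrow> omega1 \<Rightarrow> nat set" where
  "level_sym_diff A A' = (\<lambda>\<alpha>. sym_diff (A \<alpha>) (A' \<alpha>))"

lemma gap_in_iff:
  assumes T: "tower T"
  shows "gap_in T A \<longleftrightarrow> subtower T A \<and> \<not> (\<exists>X. \<forall>\<alpha>. X \<inter> T \<alpha> =\<^sup>* A \<alpha>)"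
proof (cases "subtower T A")
  case True
  let ?B = "\<lambda>\<alpha>. T \<alpha> - A \<alpha>"
  have A: "tower A" and sub: "A \<alpha> \<subseteq> T \<alpha>"
    and fin: "\<beta> < \<alpha> \<Longrightarrow> finite (A \<alpha> \<inter> (T \<beta> - A \<beta>))" for \<alpha> \<beta>
    using True by (auto simp: subtower_def)
  have "tower ?B"
    unfolding tower_def almost_subset_def
  proof (intro allI impI)
    fix \<alpha> \<beta> :: omega1 assume "\<beta> < \<alpha>"
    moreover have "?B \<beta> - ?B \<alpha> \<subseteq> (T \<beta> - T \<alpha>) \<union> (A \<alpha> \<inter> (T \<beta> - A \<beta>))" by auto
    moreover have "finite (T \<beta> - T \<alpha>)"
      using T \<open>\<beta> < \<alpha>\<close> by (simp add: tower_def almost_subset_def)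
    ultimately show "finite (?B \<beta> - ?B \<alpha>)"
      using fin[of \<beta> \<alpha>] by (meson finite_UnI finite_subset)
  qed
  moreover have "finite (A \<alpha> \<inter> ?B \<beta>)" for \<alpha> \<beta>
  proof -
    consider "\<beta> < \<alpha>" | "\<alpha> = \<beta>" | "\<alpha> < \<beta>" by (rule linorder_cases)
    then show ?thesis
    proof cases
      case 3
      have "A \<alpha> \<inter> ?B \<beta> \<subseteq> A \<alpha> - A \<beta>" by auto
      moreover have "finite (A \<alpha> - A \<beta>)" using A 3 by (simp add: tower_def almost_subset_def)
      ultimately show ?thesis by (rule finite_subset)
    qed (use fin in auto)
  qed
  moreover have "(A \<alpha> \<subseteq>\<^sup>* X \<and> finite (X \<inter> ?B \<alpha>)) \<longleftrightarrow> X \<inter> T \<alpha> =\<^sup>* A \<alpha>" for X \<alpha>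
  proof -
    have "sym_diff (X \<inter> T \<alpha>) (A \<alpha>) = (X \<inter> ?B \<alpha>) \<union> (A \<alpha> - X)" using sub[of \<alpha>] by auto
    then show ?thesis by (auto simp: almost_subset_def almost_eq_def)
  qed
  ultimately show ?thesis using True A by (simp add: gap_in_def hausdorff_gap_def)
qed (simp add: gap_in_def)

lemma subtower_iff:
  assumes "tower T"
  shows "subtower T A \<longleftrightarrow> (\<forall>\<alpha>. A \<alpha> \<subseteq> T \<alpha>) \<and> (\<forall>\<alpha>. \<forall>\<beta><\<alpha>. A \<alpha> \<inter> T \<beta> =\<^sup>* A \<beta>)"
proof -
  have "finite (sym_diff (A \<alpha> \<inter> T \<beta>) (A \<beta>)) \<longleftrightarrow>
      finite (A \<beta> - A \<alpha>) \<and> finite (A \<alpha> \<inter> (T \<beta> - A \<beta>))" if "A \<beta> \<subseteq> T \<beta>" for \<alpha> \<beta>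
  proof -
    have "sym_diff (A \<alpha> \<inter> T \<beta>) (A \<beta>) = (A \<beta> - A \<alpha>) \<union> (A \<alpha> \<inter> (T \<beta> - A \<beta>))"
      using that by auto
    then show ?thesis by simp
  qed
  then show ?thesis
    unfolding subtower_def tower_def almost_subset_def almost_eq_def by blast
qed

lemma subtower_level_sym_diff:
  assumes T: "tower T" and A: "subtower T A" and A': "subtower T A'"
  shows "subtower T (level_sym_diff A A')"
proof -
  have "level_sym_diff A A' \<alpha> \<inter> T \<beta> =\<^sup>* level_sym_diff A A' \<beta>" if "\<beta> < \<alpha>" for \<alpha> \<beta>
  proof -
    have "sym_diff (level_sym_diff A A' \<alpha> \<inter> T \<beta>) (level_sym_diff A A' \<beta>)
        \<subseteq> sym_diff (A \<alpha> \<inter> T \<beta>) (A \<beta>) \<union> sym_diff (A' \<alpha> \<inter> T \<beta>) (A' \<beta>)"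
      by (auto simp: level_sym_diff_def)
    with that A A' show ?thesis
      unfolding subtower_iff[OF T] almost_eq_def by (blast intro: finite_subset)
  qed
  moreover have "level_sym_diff A A' \<alpha> \<subseteq> T \<alpha>" for \<alpha>
    using A A' by (auto simp: level_sym_diff_def subtower_def)
  ultimately show ?thesis by (auto simp: subtower_iff[OF T])
qed

text \<open>
  The relation is taken on all subtowers: a levelwise symmetric difference of two gaps may fail
  to be a gap, and the subtowers that are not gaps form a single class, the neutral element of
  the group below.
\<close>

definition cohomologous ::
    "(omega1 \<Rightarrow> nat set) \<Rightarrow> ((omega1 \<Rightarrow> nat set) \<times> (omega1 \<Rightarrow> nat set)) set" where
  "cohomologous T =
     {(A, A'). subtower T A \<and> subtower T A' \<and> \<not> gap_in T (level_sym_diff A A')}"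

definition gap_group :: "(omega1 \<Rightarrow> nat set) \<Rightarrow> (omega1 \<Rightarrow> nat set) set monoid" where
  "gap_group T = \<lparr>
     carrier = insert {A. subtower T A \<and> \<not> gap_in T A} ({A. gap_in T A} // cohomologous T),
     mult = (\<lambda>P Q. \<Union>A\<in>P. \<Union>A'\<in>Q. cohomologous T `` {level_sym_diff A A'}),
     one = {A. subtower T A \<and> \<not> gap_in T A}\<rparr>"

lemma not_gap_in_level_sym_diff:
  assumes T: "tower T" and A: "subtower T A" "\<not> gap_in T A" and A': "subtower T A'" "\<not> gap_in T A'"
  shows "\<not> gap_in T (level_sym_diff A A')"
proof -
  obtain X Y where X: "\<And>\<alpha>. X \<inter> T \<alpha> =\<^sup>* A \<alpha>" and Y: "\<And>\<alpha>. Y \<inter> T \<alpha> =\<^sup>* A' \<alpha>"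
    using A A' by (auto simp: gap_in_iff[OF T])
  have "sym_diff X Y \<inter> T \<alpha> =\<^sup>* level_sym_diff A A' \<alpha>" for \<alpha>
  proof -
    have "sym_diff (sym_diff X Y \<inter> T \<alpha>) (level_sym_diff A A' \<alpha>)
        \<subseteq> sym_diff (X \<inter> T \<alpha>) (A \<alpha>) \<union> sym_diff (Y \<inter> T \<alpha>) (A' \<alpha>)"
      by (auto simp: level_sym_diff_def)
    then show ?thesis
      using X[of \<alpha>] Y[of \<alpha>] unfolding almost_eq_def by (blast intro: finite_subset)
  qed
  then show ?thesis by (auto simp: gap_in_iff[OF T])
qed

lemma level_sym_diff_simps:
  "level_sym_diff A B = level_sym_diff B A"
  "level_sym_diff A A = (\<lambda>_. {})"
  "level_sym_diff A (\<lambda>_. {}) = A"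
  "level_sym_diff (level_sym_diff A B) (level_sym_diff B C) = level_sym_diff A C"
  "level_sym_diff (level_sym_diff A B) (level_sym_diff C D) =
     level_sym_diff (level_sym_diff A C) (level_sym_diff B D)"
  by (auto simp: level_sym_diff_def fun_eq_iff)

lemma not_gap_in_empty: "tower T \<Longrightarrow> subtower T (\<lambda>_. {}) \<and> \<not> gap_in T (\<lambda>_. {})"
  by (auto simp: gap_in_iff subtower_iff almost_eq_def intro: exI[of _ "{}"])

lemma equiv_cohomologous:
  assumes T: "tower T"
  shows "equiv {A. subtower T A} (cohomologous T)"
proof (rule equivI)
  show "cohomologous T \<subseteq> {A. subtower T A} \<times> {A. subtower T A}"
    by (auto simp: cohomologous_def)
  show "refl_on {A. subtower T A} (cohomologous T)"
    using not_gap_in_empty[OF T] by (auto simp: refl_on_def cohomologous_def level_sym_diff_simps(2))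
  show "sym (cohomologous T)"
    by (auto simp: sym_def cohomologous_def level_sym_diff_simps(1))
  show "trans (cohomologous T)"
  proof (rule transI)
    fix A B C assume "(A, B) \<in> cohomologous T" "(B, C) \<in> cohomologous T"
    then show "(A, C) \<in> cohomologous T"
      using not_gap_in_level_sym_diff[OF T, of "level_sym_diff A B" "level_sym_diff B C"]
      by (auto simp: cohomologous_def subtower_level_sym_diff[OF T] level_sym_diff_simps(4))
  qed
qed

lemma cohomologous_class_trivial:
  assumes T: "tower T" and A: "subtower T A" "\<not> gap_in T A"
  shows "cohomologous T `` {A} = {A. subtower T A \<and> \<not> gap_in T A}"
proof -
  have E: "(\<lambda>_. {}, B) \<in> cohomologous T \<longleftrightarrow> subtower T B \<and> \<not> gap_in T B" for B
    using not_gap_in_empty[OF T]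
    by (auto simp: cohomologous_def level_sym_diff_simps(1)[of "\<lambda>_. {}"] level_sym_diff_simps(3))
  with A have "cohomologous T `` {A} = cohomologous T `` {\<lambda>_. {}}"
    using equiv_class_eq[OF equiv_cohomologous[OF T]] by metis
  then show ?thesis using E by auto
qed

lemma carrier_gap_group:
  assumes T: "tower T"
  shows "carrier (gap_group T) = {A. subtower T A} // cohomologous T"
proof -
  have "{A. subtower T A} = {A. subtower T A \<and> \<not> gap_in T A} \<union> {A. gap_in T A}"
    by (auto simp: gap_in_def)
  moreover have "{A. subtower T A \<and> \<not> gap_in T A} // cohomologous T =
      {{A. subtower T A \<and> \<not> gap_in T A}}"
    using not_gap_in_empty[OF T] cohomologous_class_trivial[OF T]
    unfolding quotient_def by blast
  ultimately show ?thesis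
    by (simp add: gap_group_def quotient_def)
qed

lemma mult_gap_group:
  assumes T: "tower T" and A: "subtower T A" and B: "subtower T B"
  shows "cohomologous T `` {A} \<otimes>\<^bsub>gap_group T\<^esub> cohomologous T `` {B} =
    cohomologous T `` {level_sym_diff A B}"
proof -
  note E = equiv_cohomologous[OF T]
  let ?C = "cohomologous T `` {level_sym_diff A B}"
  have eq: "cohomologous T `` {level_sym_diff A' B'} = ?C"
    if "A' \<in> cohomologous T `` {A}" "B' \<in> cohomologous T `` {B}" for A' B'
  proof (rule equiv_class_eq[OF E, symmetric])
    show "(level_sym_diff A B, level_sym_diff A' B') \<in> cohomologous T"
    proof -
      have "subtower T A'" "subtower T B'"
        "\<not> gap_in T (level_sym_diff A A')" "\<not> gap_in T (level_sym_diff B B')"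
        using that by (simp_all add: cohomologous_def)
      moreover from this
      have "\<not> gap_in T (level_sym_diff (level_sym_diff A A') (level_sym_diff B B'))"
        by (simp add: not_gap_in_level_sym_diff[OF T] subtower_level_sym_diff[OF T] A B)
      ultimately show ?thesis
        unfolding cohomologous_def
        by (simp add: subtower_level_sym_diff[OF T] A B
            level_sym_diff_simps(5)[of A B A' B'])
    qed
  qed
  have self: "A \<in> cohomologous T `` {A}" "B \<in> cohomologous T `` {B}"
    using equiv_class_self[OF E] A B by simp_all
  have "(\<Union>A'\<in>cohomologous T `` {A}. \<Union>B'\<in>cohomologous T `` {B}.
      cohomologous T `` {level_sym_diff A' B'}) =
    (\<Union>A'\<in>cohomologous T `` {A}. \<Union>B'\<in>cohomologous T `` {B}. ?C)"
    by (intro SUP_cong refl eq)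
  also have "\<dots> = ?C"
    using self by blast
  finally show ?thesis
    by (simp add: gap_group_def)
qed


section \<open>Cohomology of the system \<open>(\<D>, F)\<close>\<close>

definition tower_family :: "(omega1 \<Rightarrow> nat set) \<Rightarrow> nat set set" where
  "tower_family T = {D. \<exists>\<alpha>. T \<alpha> \<subseteq> D \<and> finite (D - T \<alpha>)}"

definition Z2_group :: "bit monoid" where
  "Z2_group = \<lparr>carrier = UNIV, mult = (+), one = 0\<rparr>"

definition F_group :: "nat set \<Rightarrow> (nat \<Rightarrow> bit) monoid" where
  "F_group D = sum_group D (\<lambda>_. Z2_group)"

lemma group_Z2_group: "group Z2_group"
proof (rule groupI)
  fix x assume "x \<in> carrier Z2_group"
  then show "\<exists>y\<in>carrier Z2_group. y \<otimes>\<^bsub>Z2_group\<^esub> x = \<one>\<^bsub>Z2_group\<^esub>"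
    by (intro bexI[of _ "- x"]) (auto simp: Z2_group_def)
qed (auto simp: Z2_group_def add.assoc)

lemma carrier_F_group:
  "carrier (F_group D) = {f \<in> extensional D. finite {k \<in> D. f k \<noteq> 0}}"
  unfolding F_group_def carrier_sum_group[OF group_Z2_group]
  by (auto simp: Z2_group_def PiE_iff)

text \<open>A chain \<open>D\<^sub>0 \<supseteq> \<dots> \<supseteq> D\<^sub>n\<close> is the list \<open>[D\<^sub>0, \<dots>, D\<^sub>n]\<close>; repetitions are allowed.\<close>

definition decreasing_chains :: "nat set set \<Rightarrow> nat \<Rightarrow> nat set list set" where
  "decreasing_chains \<D> n = {c. length c = Suc n \<and> set c \<subseteq> \<D> \<and> sorted_wrt (\<supseteq>) c}"

definition cochain_group :: "nat set set \<Rightarrow> nat \<Rightarrow> (nat set list \<Rightarrow> nat \<Rightarrow> bit) monoid" where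
  "cochain_group \<D> n = product_group (decreasing_chains \<D> n) (\<lambda>c. F_group (last c))"

definition omit :: "nat \<Rightarrow> 'a list \<Rightarrow> 'a list" where
  "omit i c = take i c @ drop (Suc i) c"

text \<open>
  For \<open>i \<le> n\<close>, omitting \<open>D\<^sub>i\<close> leaves the last set \<open>D\<^bsub>n+1\<^esub>\<close> in place; only the summand omitting
  \<open>D\<^bsub>n+1\<^esub>\<close> itself has to be restricted, from \<open>D\<^sub>n\<close> to \<open>D\<^bsub>n+1\<^esub>\<close>.
\<close>

definition coboundary ::
    "nat set set \<Rightarrow> nat \<Rightarrow> (nat set list \<Rightarrow> nat \<Rightarrow> bit) \<Rightarrow> nat set list \<Rightarrow> nat \<Rightarrow> bit" where
  "coboundary \<D> n x =
     (\<lambda>c \<in> decreasing_chains \<D> (Suc n). \<lambda>k \<in> last c.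
        (\<Sum>i\<le>n. (-1) ^ i * x (omit i c) k) +
        (-1) ^ Suc n * restrict (x (omit (Suc n) c)) (last c) k)"

definition cocycles :: "nat set set \<Rightarrow> nat \<Rightarrow> (nat set list \<Rightarrow> nat \<Rightarrow> bit) set" where
  "cocycles \<D> n = kernel (cochain_group \<D> n) (cochain_group \<D> (Suc n)) (coboundary \<D> n)"

definition coboundaries :: "nat set set \<Rightarrow> nat \<Rightarrow> (nat set list \<Rightarrow> nat \<Rightarrow> bit) set" where
  "coboundaries \<D> n =
     (case n of 0 \<Rightarrow> {\<one>\<^bsub>cochain_group \<D> 0\<^esub>}
      | Suc m \<Rightarrow> coboundary \<D> m ` carrier (cochain_group \<D> m))"

definition cohomology_group ::
    "nat set set \<Rightarrow> nat \<Rightarrow> (nat set list \<Rightarrow> nat \<Rightarrow> bit) set monoid" where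
  "cohomology_group \<D> n =
     (cochain_group \<D> n)\<lparr>carrier := cocycles \<D> n\<rparr> Mod coboundaries \<D> n"

end

theory Submission
  imports Defs
begin

text \<open>
  Let \<open>P\<close> be the system of all functions \<open>D \<rightarrow> \<int>/2\<close>, of which \<open>F\<close> is the subsystem of finitely
  supported ones. The idea is that \<open>P\<close> has no first cohomology, so that a class in
  \<open>H\<^sup>1(\<D>, F)\<close> comes from a family of functions on the \<open>D \<in> \<D>\<close> that is coherent modulo finite; read on
  the levels \<open>D = T\<^sub>\<alpha>\<close> as a family of sets, such a family is a subtower of \<open>T\<close>.

  In detail, \<open>P\<close> splits into the constant systems \<open>\<int>/2\<close> on \<open>{D \<in> \<D>. k \<in> D}\<close>, one for each \<open>k\<close>.
  Since \<open>\<D>\<close> is closed under finite unions, these posets are directed, and any 1-cocycle \<open>x\<close> has a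
  primitive \<open>y\<close> in \<open>P\<close>: fix a member \<open>B\<^sub>k \<ni> k\<close> of \<open>\<D>\<close> and go from \<open>B\<^sub>k\<close> to \<open>D\<close> through \<open>B\<^sub>k \<union> D\<close>
  (\<open>cocycle_eq_primitive\<close>). The explicit formula makes \<open>y\<close> additive in \<open>x\<close>, whence a homomorphism
  from cocycles to classes of subtowers, \<open>A\<^sub>\<alpha> = {k \<in> T\<^sub>\<alpha>. y(T\<^sub>\<alpha>)(k) = 1}\<close>. The values of \<open>x\<close> are
  finitely supported, which is the coherence of \<open>A\<close> (\<open>subtower_subtower_of\<close>).

  If a set \<open>X\<close> traces \<open>A\<close> on the tower, then \<open>y(D) + 1\<^sub>X\<close> is finitely supported for every \<open>D \<in> \<D>\<close>
  and still a primitive of \<open>x\<close>, so \<open>x\<close> is a coboundary in \<open>F\<close>. Conversely any two primitives in \<open>P\<close>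
  differ by one function of \<open>k\<close> alone (\<open>primitive_unique\<close>), that is, by a set \<open>X\<close>; so a coboundary
  yields a subtower that is not a gap (\<open>subtower_of_trivial_iff\<close>), and the subtower obtained
  from the coboundary in \<open>P\<close> of a given subtower is cohomologous to that subtower
  (\<open>ex_cocycle_cohomologous\<close>). The first isomorphism theorem concludes.
\<close>

section \<open>The gap group\<close>

lemma group_gap_group:
  assumes T: "tower T"
  shows "group (gap_group T)"
proof (rule groupI)
  let ?c = "\<lambda>A. cohomologous T `` {A}"
  note mult = mult_gap_group[OF T] and sub = subtower_level_sym_diff[OF T]
  have carr: "P \<in> carrier (gap_group T) \<longleftrightarrow> (\<exists>A. subtower T A \<and> P = ?c A)" for P
    by (auto simp: carrier_gap_group[OF T] quotient_def)
  have one: "\<one>\<^bsub>gap_group T\<^esub> = ?c (\<lambda>_. {})"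
    using cohomologous_class_trivial[OF T, of "\<lambda>_. {}"] not_gap_in_empty[OF T]
    by (simp add: gap_group_def)
  show "P \<otimes>\<^bsub>gap_group T\<^esub> Q \<in> carrier (gap_group T)"
    if PQ: "P \<in> carrier (gap_group T)" "Q \<in> carrier (gap_group T)" for P Q
  proof -
    obtain A B where "subtower T A" "subtower T B" "P = ?c A" "Q = ?c B"
      using PQ unfolding carr by blast
    then show ?thesis unfolding carr by (intro exI[of _ "level_sym_diff A B"]) (simp add: mult sub)
  qed
  show "\<one>\<^bsub>gap_group T\<^esub> \<in> carrier (gap_group T)"
    using not_gap_in_empty[OF T] unfolding carr one by blast
  show "P \<otimes>\<^bsub>gap_group T\<^esub> Q \<otimes>\<^bsub>gap_group T\<^esub> R = P \<otimes>\<^bsub>gap_group T\<^esub> (Q \<otimes>\<^bsub>gap_group T\<^esub> R)"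
    if PQR: "P \<in> carrier (gap_group T)" "Q \<in> carrier (gap_group T)" "R \<in> carrier (gap_group T)"
    for P Q R
  proof -
    obtain A B C where ABC: "subtower T A" "subtower T B" "subtower T C"
      and eq: "P = ?c A" "Q = ?c B" "R = ?c C"
      using PQR unfolding carr by blast
    have "level_sym_diff (level_sym_diff A B) C = level_sym_diff A (level_sym_diff B C)"
      by (auto simp: level_sym_diff_def fun_eq_iff)
    then show ?thesis by (simp add: eq ABC mult sub)
  qed
  show "\<one>\<^bsub>gap_group T\<^esub> \<otimes>\<^bsub>gap_group T\<^esub> P = P"
    if P: "P \<in> carrier (gap_group T)" for P
  proof -
    obtain A where A: "subtower T A" "P = ?c A" using P unfolding carr by blast
    moreover have "level_sym_diff (\<lambda>_. {}) A = A" by (simp add: level_sym_diff_def)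
    ultimately show ?thesis using not_gap_in_empty[OF T] by (simp add: one mult)
  qed
  show "\<exists>Q\<in>carrier (gap_group T). Q \<otimes>\<^bsub>gap_group T\<^esub> P = \<one>\<^bsub>gap_group T\<^esub>"
    if P: "P \<in> carrier (gap_group T)" for P
  proof -
    obtain A where A: "subtower T A" "P = ?c A" using P unfolding carr by blast
    have "P \<otimes>\<^bsub>gap_group T\<^esub> P = \<one>\<^bsub>gap_group T\<^esub>"
      by (simp add: A one mult level_sym_diff_simps(2))
    then show ?thesis using P by blast
  qed
qed

lemma class_eq_one_iff:
  assumes T: "tower T" and A: "subtower T A"
  shows "cohomologous T `` {A} = \<one>\<^bsub>gap_group T\<^esub> \<longleftrightarrow> \<not> gap_in T A"
proof
  assume "cohomologous T `` {A} = \<one>\<^bsub>gap_group T\<^esub>"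
  moreover have "A \<in> cohomologous T `` {A}"
    using equiv_class_self[OF equiv_cohomologous[OF T]] A by simp
  ultimately show "\<not> gap_in T A" by (simp add: gap_group_def)
next
  assume "\<not> gap_in T A"
  then show "cohomologous T `` {A} = \<one>\<^bsub>gap_group T\<^esub>"
    using cohomologous_class_trivial[OF T A] by (simp add: gap_group_def)
qed


section \<open>Cochains\<close>

text \<open>Sums in \<open>\<int>/2\<close> are kept as sums, so that the additive group laws and \<open>sum\<close> apply to them.\<close>

declare add_bit_eq_xor [simp del] mult_bit_eq_and [simp del]

text \<open>The facts about degree \<open>1\<close> below would not match a degree rewritten to \<open>Suc 0\<close>.\<close>

declare One_nat_def [simp del]

lemma bit_add_eq_1_iff: "(a::bit) + b = 1 \<longleftrightarrow> (a = 1) \<noteq> (b = 1)"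
  by (cases a; cases b) simp_all

lemma bit_add_eq_1_iff_neq: "(a::bit) + b = 1 \<longleftrightarrow> a \<noteq> b"
  by (cases a; cases b) simp_all

lemma group_F_group: "group (F_group D)"
  by (simp add: F_group_def group_Z2_group)

lemma mult_F_group: "f \<otimes>\<^bsub>F_group D\<^esub> g = (\<lambda>k\<in>D. f k + g k)"
  by (simp add: F_group_def Z2_group_def)

lemma group_cochain_group: "group (cochain_group \<D> n)"
  by (simp add: cochain_group_def group_F_group)

lemma carrier_cochain_group:
  "x \<in> carrier (cochain_group \<D> n) \<longleftrightarrow>
     x \<in> extensional (decreasing_chains \<D> n) \<and>
     (\<forall>c \<in> decreasing_chains \<D> n. x c \<in> extensional (last c) \<and> finite {k \<in> last c. x c k \<noteq> 0})"
  by (auto simp: cochain_group_def PiE_iff carrier_F_group)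

lemma cochain_eqI:
  assumes "x \<in> carrier (cochain_group \<D> n)" "y \<in> carrier (cochain_group \<D> n)"
    and "\<And>c k. c \<in> decreasing_chains \<D> n \<Longrightarrow> k \<in> last c \<Longrightarrow> x c k = y c k"
  shows "x = y"
proof (rule extensionalityI)
  show "x \<in> extensional (decreasing_chains \<D> n)" "y \<in> extensional (decreasing_chains \<D> n)"
    using assms(1,2) by (simp_all add: carrier_cochain_group)
  fix c assume c: "c \<in> decreasing_chains \<D> n"
  with assms(1,2) have "x c \<in> extensional (last c)" "y c \<in> extensional (last c)"
    by (simp_all add: carrier_cochain_group)
  then show "x c = y c" by (rule extensionalityI) (rule assms(3)[OF c])
qed

lemma mult_cochain_group:
  assumes "c \<in> decreasing_chains \<D> n" "k \<in> last c"
  shows "(x \<otimes>\<^bsub>cochain_group \<D> n\<^esub> y) c k = x c k + y c k"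
  using assms by (simp add: cochain_group_def mult_F_group)

lemma omit_decreasing_chain:
  assumes c: "c \<in> decreasing_chains \<D> (Suc n)" and i: "i \<le> Suc n"
  shows "omit i c \<in> decreasing_chains \<D> n" and "last c \<subseteq> last (omit i c)"
proof -
  have len: "length c = Suc (Suc n)" and set: "set c \<subseteq> \<D>" and sorted: "sorted_wrt (\<supseteq>) c"
    using c by (auto simp: decreasing_chains_def)
  have sub: "set (omit i c) \<subseteq> set c"
    using set_take_subset[of i c] set_drop_subset[of "Suc i" c] by (auto simp: omit_def)
  have len': "length (omit i c) = Suc n" using len i by (simp add: omit_def)
  have "sorted_wrt (\<supseteq>) (take i c @ drop i c)" using sorted by simp
  moreover have "set (drop (Suc i) c) \<subseteq> set (drop i c)"
    by (rule set_drop_subset_set_drop) simp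
  ultimately have "sorted_wrt (\<supseteq>) (omit i c)"
    unfolding omit_def sorted_wrt_append using sorted_wrt_drop[OF sorted, of "Suc i"]
    by (meson subsetD)
  then show "omit i c \<in> decreasing_chains \<D> n"
    using len' sub set by (auto simp: decreasing_chains_def)
  have "sorted_wrt (\<supseteq>) (butlast c @ [last c])"
    using sorted len by (metis append_butlast_last_id list.size(3) nat.distinct(1))
  then have "\<forall>d\<in>set (butlast c @ [last c]). last c \<subseteq> d"
    by (auto simp: sorted_wrt_append)
  then have "\<forall>d\<in>set c. last c \<subseteq> d"
    using len by (metis append_butlast_last_id list.size(3) nat.distinct(1))
  moreover have "last (omit i c) \<in> set (omit i c)"
    using len' by (metis last_in_set list.size(3) nat.distinct(1))
  ultimately show "last c \<subseteq> last (omit i c)" using sub by blast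
qed

text \<open>
  Signs disappear in characteristic 2, and at points of \<open>last c\<close> the restriction in the last summand
  has no effect, so all summands have the same form.
\<close>

lemma coboundary_eq_sum:
  assumes "c \<in> decreasing_chains \<D> (Suc n)" "k \<in> last c"
  shows "coboundary \<D> n x c k = (\<Sum>i\<le>Suc n. x (omit i c) k)"
  using assms by (simp add: coboundary_def)

lemma coboundary_hom:
  "coboundary \<D> n \<in> hom (cochain_group \<D> n) (cochain_group \<D> (Suc n))"
proof -
  have closed: "coboundary \<D> n x \<in> carrier (cochain_group \<D> (Suc n))"
    if x: "x \<in> carrier (cochain_group \<D> n)" for x
    unfolding carrier_cochain_group
  proof (intro conjI ballI)
    show "coboundary \<D> n x \<in> extensional (decreasing_chains \<D> (Suc n))"
      unfolding coboundary_def by (rule restrict_extensional)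
    fix c assume c: "c \<in> decreasing_chains \<D> (Suc n)"
    show "coboundary \<D> n x c \<in> extensional (last c)"
      unfolding coboundary_def using c by simp
    have "{k \<in> last c. coboundary \<D> n x c k \<noteq> 0}
        \<subseteq> (\<Union>i\<le>Suc n. {k \<in> last (omit i c). x (omit i c) k \<noteq> 0})"
    proof
      fix k assume "k \<in> {k \<in> last c. coboundary \<D> n x c k \<noteq> 0}"
      then have k: "k \<in> last c" and "(\<Sum>i\<le>Suc n. x (omit i c) k) \<noteq> 0"
        using coboundary_eq_sum[OF c] by auto
      then obtain i where "i \<le> Suc n" "x (omit i c) k \<noteq> 0"
        by (metis (no_types, lifting) atMost_iff sum.neutral)
      then show "k \<in> (\<Union>i\<le>Suc n. {k \<in> last (omit i c). x (omit i c) k \<noteq> 0})"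
        using k omit_decreasing_chain(2)[OF c, of i] by blast
    qed
    moreover have "finite {k \<in> last (omit i c). x (omit i c) k \<noteq> 0}" if "i \<le> Suc n" for i
      using x omit_decreasing_chain(1)[OF c that] by (simp add: carrier_cochain_group)
    ultimately show "finite {k \<in> last c. coboundary \<D> n x c k \<noteq> 0}"
      by (meson atMost_iff finite_UN_I finite_atMost finite_subset)
  qed
  show ?thesis
  proof (rule homI)
    fix x y assume x: "x \<in> carrier (cochain_group \<D> n)" and y: "y \<in> carrier (cochain_group \<D> n)"
    let ?G = "cochain_group \<D> n" and ?H = "cochain_group \<D> (Suc n)"
    show "coboundary \<D> n (x \<otimes>\<^bsub>?G\<^esub> y) = coboundary \<D> n x \<otimes>\<^bsub>?H\<^esub> coboundary \<D> n y"
    proof (rule cochain_eqI)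
      show "coboundary \<D> n (x \<otimes>\<^bsub>?G\<^esub> y) \<in> carrier ?H"
        using x y by (simp add: closed group.is_monoid monoid.m_closed group_cochain_group)
      show "coboundary \<D> n x \<otimes>\<^bsub>?H\<^esub> coboundary \<D> n y \<in> carrier ?H"
        using x y closed by (meson group.is_monoid monoid.m_closed group_cochain_group)
      fix c k assume c: "c \<in> decreasing_chains \<D> (Suc n)" and k: "k \<in> last c"
      have "(x \<otimes>\<^bsub>?G\<^esub> y) (omit i c) k = x (omit i c) k + y (omit i c) k" if "i \<le> Suc n" for i
        using omit_decreasing_chain[OF c that] k by (intro mult_cochain_group) auto
      then show "coboundary \<D> n (x \<otimes>\<^bsub>?G\<^esub> y) c k =
          (coboundary \<D> n x \<otimes>\<^bsub>?H\<^esub> coboundary \<D> n y) c k"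
        unfolding mult_cochain_group[OF c k] coboundary_eq_sum[OF c k] sum.distrib[symmetric]
        by (intro sum.cong) auto
    qed
  qed (rule closed)
qed

lemma subgroup_cocycles: "subgroup (cocycles \<D> n) (cochain_group \<D> n)"
proof -
  interpret group_hom "cochain_group \<D> n" "cochain_group \<D> (Suc n)" "coboundary \<D> n"
    by (simp add: group_hom_def group_hom_axioms_def group_cochain_group coboundary_hom)
  show ?thesis unfolding cocycles_def by (rule subgroup_kernel)
qed


section \<open>Cochains in low degree\<close>

lemma decreasing_chains_0: "c \<in> decreasing_chains \<D> 0 \<longleftrightarrow> (\<exists>D\<in>\<D>. c = [D])"
  by (auto simp: decreasing_chains_def length_Suc_conv)

lemma decreasing_chains_1:
  "c \<in> decreasing_chains \<D> 1 \<longleftrightarrow> (\<exists>D\<in>\<D>. \<exists>E\<in>\<D>. E \<subseteq> D \<and> c = [D, E])"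
  by (auto simp: decreasing_chains_def length_Suc_conv One_nat_def)

lemma decreasing_chains_2:
  "c \<in> decreasing_chains \<D> 2 \<longleftrightarrow> (\<exists>C\<in>\<D>. \<exists>D\<in>\<D>. \<exists>E\<in>\<D>. D \<subseteq> C \<and> E \<subseteq> D \<and> c = [C, D, E])"
  by (auto simp: decreasing_chains_def length_Suc_conv numeral_2_eq_2)

lemma coboundary_0:
  assumes "D \<in> \<D>" "E \<in> \<D>" "E \<subseteq> D" "k \<in> E"
  shows "coboundary \<D> 0 w [D, E] k = w [E] k + w [D] k"
proof -
  have "[D, E] \<in> decreasing_chains \<D> (Suc 0)"
    using assms decreasing_chains_1[of "[D, E]" \<D>] by (simp add: One_nat_def)
  with \<open>k \<in> E\<close> show ?thesis by (simp add: coboundary_eq_sum omit_def)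
qed

lemma coboundary_1:
  assumes "C \<in> \<D>" "D \<in> \<D>" "E \<in> \<D>" "D \<subseteq> C" "E \<subseteq> D" "k \<in> E"
  shows "coboundary \<D> 1 x [C, D, E] k = x [D, E] k + x [C, E] k + x [C, D] k"
proof -
  have "[C, D, E] \<in> decreasing_chains \<D> (Suc 1)"
    using assms decreasing_chains_2[of "[C, D, E]" \<D>] by (simp add: Suc_1)
  with \<open>k \<in> E\<close> show ?thesis
    by (simp add: coboundary_eq_sum omit_def add.assoc One_nat_def)
qed

lemma cocycle_1_iff:
  "x \<in> cocycles \<D> 1 \<longleftrightarrow> x \<in> carrier (cochain_group \<D> 1) \<and>
     (\<forall>C\<in>\<D>. \<forall>D\<in>\<D>. \<forall>E\<in>\<D>. D \<subseteq> C \<longrightarrow> E \<subseteq> D \<longrightarrow> (\<forall>k\<in>E. x [C, E] k = x [C, D] k + x [D, E] k))"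
    (is "_ \<longleftrightarrow> _ \<and> ?add")
proof -
  let ?H = "cochain_group \<D> (Suc 1)"
  have "coboundary \<D> 1 x = \<one>\<^bsub>?H\<^esub> \<longleftrightarrow> ?add" if x: "x \<in> carrier (cochain_group \<D> 1)"
  proof -
    have one: "\<one>\<^bsub>?H\<^esub> c k = 0" if "c \<in> decreasing_chains \<D> (Suc 1)" "k \<in> last c" for c k
      using that by (simp add: cochain_group_def F_group_def Z2_group_def)
    have "coboundary \<D> 1 x = \<one>\<^bsub>?H\<^esub> \<longleftrightarrow>
        (\<forall>c\<in>decreasing_chains \<D> (Suc 1). \<forall>k\<in>last c. coboundary \<D> 1 x c k = 0)"
    proof
      assume zero: "\<forall>c\<in>decreasing_chains \<D> (Suc 1). \<forall>k\<in>last c. coboundary \<D> 1 x c k = 0"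
      show "coboundary \<D> 1 x = \<one>\<^bsub>?H\<^esub>"
      proof (rule cochain_eqI)
        show "coboundary \<D> 1 x \<in> carrier ?H" by (rule hom_in_carrier[OF coboundary_hom x])
        show "\<one>\<^bsub>?H\<^esub> \<in> carrier ?H"
          by (rule monoid.one_closed[OF group.is_monoid[OF group_cochain_group]])
      qed (use zero one in simp)
    qed (use one in auto)
    also have "\<dots> \<longleftrightarrow> (\<forall>C\<in>\<D>. \<forall>D\<in>\<D>. \<forall>E\<in>\<D>. D \<subseteq> C \<longrightarrow> E \<subseteq> D \<longrightarrow>
        (\<forall>k\<in>E. coboundary \<D> 1 x [C, D, E] k = 0))"
    proof -
      have "Suc 1 = 2" by simp
      show ?thesis unfolding \<open>Suc 1 = 2\<close> Ball_def decreasing_chains_2 by fastforce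
    qed
    also have "\<dots> \<longleftrightarrow> ?add"
    proof -
      have "a + b + c = 0 \<longleftrightarrow> b = c + a" for a b c :: bit
        by (cases a; cases b; cases c) simp_all
      then have "coboundary \<D> 1 x [C, D, E] k = 0 \<longleftrightarrow> x [C, E] k = x [C, D] k + x [D, E] k"
        if "C \<in> \<D>" "D \<in> \<D>" "E \<in> \<D>" "D \<subseteq> C" "E \<subseteq> D" "k \<in> E" for C D E k
        using coboundary_1[OF that] by simp
      then show ?thesis by meson
    qed
    finally show ?thesis .
  qed
  then show ?thesis unfolding cocycles_def kernel_def by auto
qed

lemma coboundaries_1_subset: "coboundaries \<D> 1 \<subseteq> cocycles \<D> 1"
proof
  fix x assume "x \<in> coboundaries \<D> 1"
  then obtain w where w: "w \<in> carrier (cochain_group \<D> 0)" and x: "x = coboundary \<D> 0 w"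
    by (auto simp: coboundaries_def One_nat_def)
  have "x [C, E] k = x [C, D] k + x [D, E] k"
    if "C \<in> \<D>" "D \<in> \<D>" "E \<in> \<D>" "D \<subseteq> C" "E \<subseteq> D" "k \<in> E" for C D E k
  proof -
    have "x [C, E] k = w [E] k + w [C] k" "x [C, D] k = w [D] k + w [C] k"
      "x [D, E] k = w [E] k + w [D] k"
      using that unfolding x by (auto intro!: coboundary_0)
    then show ?thesis by (cases "w [C] k"; cases "w [D] k"; cases "w [E] k") simp_all
  qed
  moreover have "x \<in> carrier (cochain_group \<D> 1)"
    using hom_in_carrier[OF coboundary_hom w] by (simp add: x One_nat_def)
  ultimately show "x \<in> cocycles \<D> 1" unfolding cocycle_1_iff by blast
qed

lemma finite_support_1:
  assumes "x \<in> carrier (cochain_group \<D> 1)" "D \<in> \<D>" "E \<in> \<D>" "E \<subseteq> D"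
  shows "finite {k \<in> E. x [D, E] k \<noteq> 0}"
proof -
  have "[D, E] \<in> decreasing_chains \<D> 1" using assms by (simp add: decreasing_chains_1)
  with assms(1) show ?thesis unfolding carrier_cochain_group by fastforce
qed

text \<open>
  Coherence modulo finite says that the coboundary of \<open>w\<close> has values in \<open>F\<close>, although \<open>w\<close>
  itself may not; such cocycles need not be coboundaries in \<open>F\<close>.
\<close>

lemma ex_cocycle_of_coherent_family:
  fixes w :: "nat set \<Rightarrow> nat \<Rightarrow> bit"
  assumes fin: "\<And>D E. D \<in> \<D> \<Longrightarrow> E \<in> \<D> \<Longrightarrow> E \<subseteq> D \<Longrightarrow> finite {k \<in> E. w E k \<noteq> w D k}"
  obtains x where "x \<in> cocycles \<D> 1"
    and "\<And>D E k. D \<in> \<D> \<Longrightarrow> E \<in> \<D> \<Longrightarrow> E \<subseteq> D \<Longrightarrow> k \<in> E \<Longrightarrow> x [D, E] k = w E k + w D k"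
proof
  define x where "x = (\<lambda>c\<in>decreasing_chains \<D> 1. \<lambda>k\<in>last c. w (last c) k + w (hd c) k)"
  show x: "x [D, E] k = w E k + w D k" if "D \<in> \<D>" "E \<in> \<D>" "E \<subseteq> D" "k \<in> E" for D E k
  proof -
    have "[D, E] \<in> decreasing_chains \<D> 1" using that by (simp add: decreasing_chains_1)
    with that show ?thesis by (simp add: x_def)
  qed
  have "finite {k \<in> last c. x c k \<noteq> 0}" if chain: "c \<in> decreasing_chains \<D> 1" for c
  proof -
    obtain D E where c: "c = [D, E]" "D \<in> \<D>" "E \<in> \<D>" "E \<subseteq> D"
      using chain by (auto simp: decreasing_chains_1)
    then have "{k \<in> last c. x c k \<noteq> 0} = {k \<in> E. w E k \<noteq> w D k}"
      using x by (auto simp: bit_add_eq_1_iff_neq)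
    then show ?thesis using fin c by simp
  qed
  moreover have "x \<in> extensional (decreasing_chains \<D> 1)"
    and "x c \<in> extensional (last c)" if "c \<in> decreasing_chains \<D> 1" for c
    using that by (auto simp: x_def)
  ultimately have "x \<in> carrier (cochain_group \<D> 1)"
    unfolding carrier_cochain_group by (auto simp: x_def)
  moreover have "x [C, E] k = x [C, D] k + x [D, E] k"
    if "C \<in> \<D>" "D \<in> \<D>" "E \<in> \<D>" "D \<subseteq> C" "E \<subseteq> D" "k \<in> E" for C D E k
  proof -
    have "x [C, E] k = w E k + w C k" "x [C, D] k = w D k + w C k" "x [D, E] k = w E k + w D k"
      using that by (auto intro!: x)
    then show ?thesis by (cases "w C k"; cases "w D k"; cases "w E k") simp_all
  qed
  ultimately show "x \<in> cocycles \<D> 1" unfolding cocycle_1_iff by blast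
qed


section \<open>Primitives of cocycles\<close>

lemma tower_family_level: "T \<alpha> \<in> tower_family T"
  by (auto simp: tower_family_def)

lemma tower_family_Un:
  assumes T: "tower T" and D: "D \<in> tower_family T" and E: "E \<in> tower_family T"
  shows "D \<union> E \<in> tower_family T"
proof -
  have *: "D \<union> E \<in> tower_family T"
    if D: "T \<alpha> \<subseteq> D" "finite (D - T \<alpha>)" and E: "T \<beta> \<subseteq> E" "finite (E - T \<beta>)" and "\<beta> \<le> \<alpha>"
    for D E \<alpha> \<beta>
  proof -
    have "finite (T \<beta> - T \<alpha>)"
      using T \<open>\<beta> \<le> \<alpha>\<close> by (cases "\<beta> = \<alpha>") (auto simp: tower_def almost_subset_def)
    moreover have "D \<union> E - T \<alpha> \<subseteq> (D - T \<alpha>) \<union> (E - T \<beta>) \<union> (T \<beta> - T \<alpha>)" by auto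
    ultimately have "finite (D \<union> E - T \<alpha>)"
      using D(2) E(2) by (meson finite_UnI finite_subset)
    then show ?thesis using D(1) by (auto simp: tower_family_def)
  qed
  obtain \<alpha> \<beta> where "T \<alpha> \<subseteq> D" "finite (D - T \<alpha>)" "T \<beta> \<subseteq> E" "finite (E - T \<beta>)"
    using D E by (auto simp: tower_family_def)
  then show ?thesis
    using *[of \<alpha> D \<beta> E] *[of \<beta> E \<alpha> D] linear[of \<beta> \<alpha>] by (auto simp: Un_commute)
qed

definition base_set :: "(omega1 \<Rightarrow> nat set) \<Rightarrow> nat \<Rightarrow> nat set" where
  "base_set T k = insert k (T (LEAST \<alpha>. True))"

lemma base_set: "base_set T k \<in> tower_family T" "k \<in> base_set T k"
proof -
  have "base_set T k - T (LEAST \<alpha>. True) \<subseteq> {k}" by (auto simp: base_set_def)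
  then show "base_set T k \<in> tower_family T"
    unfolding tower_family_def using finite_subset by (auto simp: base_set_def)
qed (simp add: base_set_def)

text \<open>
  The \<open>k\<close>-th coordinate of \<open>x\<close> is a cocycle on the directed poset of all \<open>D \<ni> k\<close>; its value on
  the path from \<open>base_set T k\<close> to \<open>D\<close> through their union integrates it.
\<close>

definition primitive ::
    "(omega1 \<Rightarrow> nat set) \<Rightarrow> (nat set list \<Rightarrow> nat \<Rightarrow> bit) \<Rightarrow> nat set \<Rightarrow> nat \<Rightarrow> bit" where
  "primitive T x D k =
     x [D \<union> base_set T k, D] k + x [D \<union> base_set T k, base_set T k] k"

text \<open>
  Both values of the primitive can be computed through the larger union \<open>D \<union> base_set T k\<close>, and
  then the terms leading to the base set cancel.
\<close>

lemma cocycle_eq_primitive: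
  assumes T: "tower T" and x: "x \<in> cocycles (tower_family T) 1"
    and D: "D \<in> tower_family T" and E: "E \<in> tower_family T" and "E \<subseteq> D" "k \<in> E"
  shows "x [D, E] k = primitive T x E k + primitive T x D k"
proof -
  let ?B = "base_set T k"
  have DB: "D \<union> ?B \<in> tower_family T" and EB: "E \<union> ?B \<in> tower_family T"
    using tower_family_Un[OF T] D E base_set by blast+
  have add: "x [C, E'] k = x [C, D'] k + x [D', E'] k"
    if "C \<in> tower_family T" "D' \<in> tower_family T" "E' \<in> tower_family T" "D' \<subseteq> C" "E' \<subseteq> D'" "k \<in> E'"
    for C D' E'
    using x that unfolding cocycle_1_iff by blast
  have "x [D \<union> ?B, E] k = x [D \<union> ?B, E \<union> ?B] k + x [E \<union> ?B, E] k"
    "x [D \<union> ?B, ?B] k = x [D \<union> ?B, E \<union> ?B] k + x [E \<union> ?B, ?B] k"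
    "x [D \<union> ?B, E] k = x [D \<union> ?B, D] k + x [D, E] k"
    using D E DB EB base_set[where T = T and k = k] \<open>E \<subseteq> D\<close> \<open>k \<in> E\<close> by (auto intro!: add)
  then show ?thesis
    unfolding primitive_def
    by (cases "x [D, E] k"; cases "x [D \<union> ?B, D] k"; cases "x [D \<union> ?B, E \<union> ?B] k";
        cases "x [E \<union> ?B, E] k"; cases "x [E \<union> ?B, ?B] k") simp_all
qed

text \<open>
  The correction \<open>w (base_set T k) k\<close> depends on \<open>k\<close> only: it is the normalisation of the primitive
  to vanish at the base sets.
\<close>

lemma primitive_unique:
  assumes T: "tower T" and D: "D \<in> tower_family T" "k \<in> D"
    and w: "\<And>D E k. D \<in> tower_family T \<Longrightarrow> E \<in> tower_family T \<Longrightarrow> E \<subseteq> D \<Longrightarrow> k \<in> E \<Longrightarrow>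
              x [D, E] k = w E k + w D k"
  shows "primitive T x D k = w D k + w (base_set T k) k"
proof -
  let ?B = "base_set T k"
  have "D \<union> ?B \<in> tower_family T" using tower_family_Un[OF T D(1) base_set(1)] .
  then have "primitive T x D k = (w D k + w (D \<union> ?B) k) + (w ?B k + w (D \<union> ?B) k)"
    unfolding primitive_def using D base_set[where T = T and k = k] by (subst (1 2) w) auto
  then show ?thesis by (cases "w D k"; cases "w ?B k"; cases "w (D \<union> ?B) k") simp_all
qed

lemma primitive_mult:
  assumes T: "tower T" and D: "D \<in> tower_family T" "k \<in> D"
  shows "primitive T (x \<otimes>\<^bsub>cochain_group (tower_family T) 1\<^esub> y) D k =
    primitive T x D k + primitive T y D k"
proof -
  let ?B = "base_set T k"
  have "D \<union> ?B \<in> tower_family T" using tower_family_Un[OF T D(1) base_set(1)] .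
  then have "[D \<union> ?B, D] \<in> decreasing_chains (tower_family T) 1"
    "[D \<union> ?B, ?B] \<in> decreasing_chains (tower_family T) 1"
    using D base_set[where T = T and k = k] by (auto simp: decreasing_chains_1)
  then show ?thesis
    unfolding primitive_def using D base_set[where T = T and k = k]
    by (simp add: mult_cochain_group algebra_simps)
qed

lemma primitive_coherent:
  assumes T: "tower T" and x: "x \<in> cocycles (tower_family T) 1"
    and D: "D \<in> tower_family T" and E: "E \<in> tower_family T" and "E \<subseteq> D"
  shows "finite {k \<in> E. primitive T x E k \<noteq> primitive T x D k}"
proof -
  have "{k \<in> E. primitive T x E k \<noteq> primitive T x D k} = {k \<in> E. x [D, E] k \<noteq> 0}"
    using cocycle_eq_primitive[OF assms] by (auto simp: bit_add_eq_1_iff_neq)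
  then show ?thesis
    using finite_support_1[of x "tower_family T" D E] x D E \<open>E \<subseteq> D\<close> unfolding cocycle_1_iff by simp
qed


section \<open>From cocycles to subtowers\<close>

definition subtower_of ::
    "(omega1 \<Rightarrow> nat set) \<Rightarrow> (nat set list \<Rightarrow> nat \<Rightarrow> bit) \<Rightarrow> omega1 \<Rightarrow> nat set" where
  "subtower_of T x = (\<lambda>\<alpha>. {k \<in> T \<alpha>. primitive T x (T \<alpha>) k = 1})"

text \<open>
  Although \<open>T\<^sub>\<beta>\<close> need not be contained in \<open>T\<^sub>\<alpha>\<close>, the primitive at either level can be compared with
  the primitive at \<open>T\<^sub>\<alpha> \<union> T\<^sub>\<beta>\<close>.
\<close>

lemma subtower_subtower_of:
  assumes T: "tower T" and x: "x \<in> cocycles (tower_family T) 1"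
  shows "subtower T (subtower_of T x)"
  unfolding subtower_iff[OF T] almost_eq_def
proof (intro conjI allI impI)
  show "subtower_of T x \<alpha> \<subseteq> T \<alpha>" for \<alpha> by (auto simp: subtower_of_def)
  fix \<alpha> \<beta> :: omega1 assume "\<beta> < \<alpha>"
  let ?p = "primitive T x" and ?U = "T \<alpha> \<union> T \<beta>"
  have U: "?U \<in> tower_family T" by (simp add: T tower_family_Un tower_family_level)
  have "finite {k \<in> T \<gamma>. ?p (T \<gamma>) k \<noteq> ?p ?U k}" if "\<gamma> = \<alpha> \<or> \<gamma> = \<beta>" for \<gamma>
    using that by (intro primitive_coherent T x U tower_family_level) auto
  moreover have "finite (T \<beta> - T \<alpha>)"
    using T \<open>\<beta> < \<alpha>\<close> by (simp add: tower_def almost_subset_def)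
  ultimately have "finite ({k \<in> T \<alpha>. ?p (T \<alpha>) k \<noteq> ?p ?U k} \<union> {k \<in> T \<beta>. ?p (T \<beta>) k \<noteq> ?p ?U k}
      \<union> (T \<beta> - T \<alpha>))" by simp
  moreover have "sym_diff (subtower_of T x \<alpha> \<inter> T \<beta>) (subtower_of T x \<beta>) \<subseteq>
      {k \<in> T \<alpha>. ?p (T \<alpha>) k \<noteq> ?p ?U k} \<union> {k \<in> T \<beta>. ?p (T \<beta>) k \<noteq> ?p ?U k} \<union> (T \<beta> - T \<alpha>)"
    by (auto simp: subtower_of_def)
  ultimately show "finite (sym_diff (subtower_of T x \<alpha> \<inter> T \<beta>) (subtower_of T x \<beta>))"
    by (rule finite_subset[rotated])
qed

lemma subtower_of_mult:
  assumes T: "tower T"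
  shows "subtower_of T (x \<otimes>\<^bsub>cochain_group (tower_family T) 1\<^esub> y) =
    level_sym_diff (subtower_of T x) (subtower_of T y)"
  by (auto simp: subtower_of_def level_sym_diff_def fun_eq_iff bit_add_eq_1_iff
      primitive_mult[OF T tower_family_level])

text \<open>
  If \<open>X\<close> traces the subtower, adding the indicator function of \<open>X\<close> makes the primitive finitely
  supported on each level, hence by coherence on each \<open>D \<in> \<D>\<close>; and the addition of a function of
  \<open>k\<close> alone does not change the coboundary. In the other direction, a primitive \<open>w\<close> in \<open>F\<close>
  differs from the normalised one by a function of \<open>k\<close> alone, which is the indicator function of
  the required \<open>X\<close>.
\<close>

lemma subtower_of_trivial_iff:
  assumes T: "tower T" and x: "x \<in> cocycles (tower_family T) 1"
  shows "\<not> gap_in T (subtower_of T x) \<longleftrightarrow> x \<in> coboundaries (tower_family T) 1"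
proof
  let ?\<D> = "tower_family T" and ?p = "primitive T x"
  assume "\<not> gap_in T (subtower_of T x)"
  then obtain X where X: "\<And>\<alpha>. X \<inter> T \<alpha> =\<^sup>* subtower_of T x \<alpha>"
    using subtower_subtower_of[OF T x] by (auto simp: gap_in_iff[OF T])
  define w where "w = (\<lambda>c\<in>decreasing_chains ?\<D> 0. \<lambda>k\<in>last c. ?p (last c) k + of_bool (k \<in> X))"
  have w: "w [D] = (\<lambda>k\<in>D. ?p D k + of_bool (k \<in> X))" if "D \<in> ?\<D>" for D
    using that by (simp add: w_def decreasing_chains_0)
  have "finite {k \<in> D. w [D] k \<noteq> 0}" if D: "D \<in> ?\<D>" for D
  proof -
    obtain \<alpha> where \<alpha>: "T \<alpha> \<subseteq> D" "finite (D - T \<alpha>)" using D by (auto simp: tower_family_def)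
    have "finite {k \<in> T \<alpha>. ?p (T \<alpha>) k \<noteq> ?p D k}"
      by (rule primitive_coherent[OF T x D tower_family_level \<alpha>(1)])
    moreover have "finite (sym_diff (X \<inter> T \<alpha>) (subtower_of T x \<alpha>))"
      using X[of \<alpha>] by (simp add: almost_eq_def)
    ultimately have "finite ((D - T \<alpha>) \<union> {k \<in> T \<alpha>. ?p (T \<alpha>) k \<noteq> ?p D k} \<union>
        sym_diff (X \<inter> T \<alpha>) (subtower_of T x \<alpha>))"
      using \<alpha>(2) by simp
    moreover have "{k \<in> D. w [D] k \<noteq> 0} \<subseteq> (D - T \<alpha>) \<union> {k \<in> T \<alpha>. ?p (T \<alpha>) k \<noteq> ?p D k} \<union>
        sym_diff (X \<inter> T \<alpha>) (subtower_of T x \<alpha>)"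
      by (auto simp: w[OF D] subtower_of_def bit_add_eq_1_iff)
    ultimately show ?thesis by (rule finite_subset[rotated])
  qed
  then have w_carrier: "w \<in> carrier (cochain_group ?\<D> 0)"
    unfolding carrier_cochain_group by (auto simp: decreasing_chains_0 w) (simp add: w_def)
  have "coboundary ?\<D> 0 w = x"
  proof (rule cochain_eqI)
    show "coboundary ?\<D> 0 w \<in> carrier (cochain_group ?\<D> 1)"
      using hom_in_carrier[OF coboundary_hom w_carrier] by (simp add: One_nat_def)
    show "x \<in> carrier (cochain_group ?\<D> 1)" using x by (simp add: cocycle_1_iff)
    fix c k assume "c \<in> decreasing_chains ?\<D> 1" and k: "k \<in> last c"
    then obtain D E where c: "c = [D, E]" "D \<in> ?\<D>" "E \<in> ?\<D>" "E \<subseteq> D" "k \<in> E"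
      by (auto simp: decreasing_chains_1)
    have "coboundary ?\<D> 0 w c k = (?p E k + of_bool (k \<in> X)) + (?p D k + of_bool (k \<in> X))"
      using c by (auto simp: coboundary_0 w)
    also have "\<dots> = ?p E k + ?p D k"
      by (cases "?p E k"; cases "?p D k") simp_all
    also have "\<dots> = x c k"
      using cocycle_eq_primitive[OF T x] c by simp
    finally show "coboundary ?\<D> 0 w c k = x c k" .
  qed
  then show "x \<in> coboundaries ?\<D> 1" using w_carrier by (auto simp: coboundaries_def One_nat_def)
next
  let ?\<D> = "tower_family T"
  assume "x \<in> coboundaries ?\<D> 1"
  then obtain w where w: "w \<in> carrier (cochain_group ?\<D> 0)" and x_eq: "x = coboundary ?\<D> 0 w"
    by (auto simp: coboundaries_def One_nat_def)
  let ?X = "{k. w [base_set T k] k = 1}"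
  have "?X \<inter> T \<alpha> =\<^sup>* subtower_of T x \<alpha>" for \<alpha>
  proof -
    have "primitive T x (T \<alpha>) k = w [T \<alpha>] k + w [base_set T k] k" if "k \<in> T \<alpha>" for k
      using that
      by (intro primitive_unique[OF T, where w = "\<lambda>D. w [D]"])
        (auto simp: x_eq tower_family_level intro!: coboundary_0)
    then have "sym_diff (?X \<inter> T \<alpha>) (subtower_of T x \<alpha>) \<subseteq> {k \<in> T \<alpha>. w [T \<alpha>] k \<noteq> 0}"
      by (auto simp: subtower_of_def bit_add_eq_1_iff)
    moreover have "finite {k \<in> T \<alpha>. w [T \<alpha>] k \<noteq> 0}"
    proof -
      have "[T \<alpha>] \<in> decreasing_chains ?\<D> 0" by (simp add: decreasing_chains_0 tower_family_level)
      with w show ?thesis unfolding carrier_cochain_group by fastforce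
    qed
    ultimately show ?thesis unfolding almost_eq_def by (rule finite_subset)
  qed
  then show "\<not> gap_in T (subtower_of T x)" by (auto simp: gap_in_iff[OF T])
qed


section \<open>From subtowers to cocycles\<close>

text \<open>
  Distinct levels of \<open>T\<close> may be equal modulo finite, so \<open>T\<^sub>\<beta> \<subseteq>\<^sup>* T\<^sub>\<alpha>\<close> does not force
  \<open>\<beta> \<le> \<alpha>\<close>. Coherence of a subtower is needed in this form because a member of \<open>\<D>\<close> does
  not determine the level that it is close to.
\<close>

lemma subtower_restrict:
  assumes T: "tower T" and A: "subtower T A" and sub: "T \<beta> \<subseteq>\<^sup>* T \<alpha>"
  shows "A \<alpha> \<inter> T \<beta> =\<^sup>* A \<beta>"
proof -
  have A_sub: "A \<gamma> \<subseteq> T \<gamma>" and coh: "\<delta> < \<gamma> \<Longrightarrow> A \<gamma> \<inter> T \<delta> =\<^sup>* A \<delta>" for \<gamma> \<delta>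
    using A by (auto simp: subtower_iff[OF T])
  consider "\<beta> < \<alpha>" | "\<alpha> = \<beta>" | "\<alpha> < \<beta>" by (rule linorder_cases)
  then show ?thesis
  proof cases
    case 1
    then show ?thesis by (rule coh)
  next
    case 2
    then show ?thesis using A_sub[of \<beta>] by (simp add: almost_eq_def Int_absorb2)
  next
    case 3
    have "sym_diff (A \<alpha> \<inter> T \<beta>) (A \<beta>) \<subseteq> sym_diff (A \<beta> \<inter> T \<alpha>) (A \<alpha>) \<union> (T \<beta> - T \<alpha>)"
      using A_sub[of \<beta>] by auto
    then show ?thesis
      using coh[OF 3] sub unfolding almost_eq_def almost_subset_def
      by (meson finite_UnI finite_subset)
  qed
qed

lemma subtower_coherent_on_family:
  assumes T: "tower T" and A: "subtower T A" and "E \<subseteq> D"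
    and D: "T \<alpha> \<subseteq> D" "finite (D - T \<alpha>)" and E: "T \<beta> \<subseteq> E" "finite (E - T \<beta>)"
  shows "finite (E \<inter> sym_diff (A \<alpha>) (A \<beta>))"
proof -
  have "T \<beta> - T \<alpha> \<subseteq> D - T \<alpha>" using E(1) \<open>E \<subseteq> D\<close> by auto
  then have "T \<beta> \<subseteq>\<^sup>* T \<alpha>" using D(2) unfolding almost_subset_def by (rule finite_subset)
  then have "finite (sym_diff (A \<alpha> \<inter> T \<beta>) (A \<beta>))"
    using subtower_restrict[OF T A] by (simp add: almost_eq_def)
  moreover have "E \<inter> sym_diff (A \<alpha>) (A \<beta>) \<subseteq> (E - T \<beta>) \<union> sym_diff (A \<alpha> \<inter> T \<beta>) (A \<beta>)" by auto
  ultimately show ?thesis using E(2) by (meson finite_UnI finite_subset)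
qed

text \<open>
  The cocycle is the coboundary of the indicator functions of the sets \<open>A\<^sub>\<alpha>\<close>, where each
  \<open>D \<in> \<D>\<close> is assigned a level \<open>T\<^sub>\<alpha>\<close> that it equals modulo finite. Going back to a subtower
  passes to the normalised primitive, and so changes \<open>A\<close> by a single subset of \<open>\<omega>\<close>.
\<close>

lemma ex_cocycle_cohomologous:
  assumes T: "tower T" and A: "subtower T A"
  obtains x where "x \<in> cocycles (tower_family T) 1" and "(A, subtower_of T x) \<in> cohomologous T"
proof -
  let ?\<D> = "tower_family T"
  define level where "level D = (SOME \<alpha>. T \<alpha> \<subseteq> D \<and> finite (D - T \<alpha>))" for D
  have level: "T (level D) \<subseteq> D" "finite (D - T (level D))" if "D \<in> ?\<D>" for D
    using someI_ex[of "\<lambda>\<alpha>. T \<alpha> \<subseteq> D \<and> finite (D - T \<alpha>)"] that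
    by (auto simp: level_def tower_family_def)
  define w :: "nat set \<Rightarrow> nat \<Rightarrow> bit" where "w D k = of_bool (k \<in> A (level D))" for D k
  have "finite {k \<in> E. w E k \<noteq> w D k}" if "D \<in> ?\<D>" "E \<in> ?\<D>" "E \<subseteq> D" for D E
  proof -
    have "{k \<in> E. w E k \<noteq> w D k} = E \<inter> sym_diff (A (level D)) (A (level E))"
      by (auto simp: w_def)
    then show ?thesis using subtower_coherent_on_family[OF T A that(3)] level that by simp
  qed
  then obtain x where x: "x \<in> cocycles ?\<D> 1"
    and x_eq: "\<And>D E k. D \<in> ?\<D> \<Longrightarrow> E \<in> ?\<D> \<Longrightarrow> E \<subseteq> D \<Longrightarrow> k \<in> E \<Longrightarrow> x [D, E] k = w E k + w D k"
    using ex_cocycle_of_coherent_family[of ?\<D> w] by blast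
  note sub = subtower_subtower_of[OF T x]
  \<comment> \<open>The primitives \<open>w\<close> and \<open>primitive T x\<close> of \<open>x\<close> differ by the indicator function of this set.\<close>
  let ?Z = "{k. w (base_set T k) k = 1}"
  have "?Z \<inter> T \<alpha> =\<^sup>* level_sym_diff A (subtower_of T x) \<alpha>" for \<alpha>
  proof -
    have "primitive T x (T \<alpha>) k = w (T \<alpha>) k + w (base_set T k) k" if "k \<in> T \<alpha>" for k
      using primitive_unique[of T "T \<alpha>" k x w] T tower_family_level that x_eq by blast
    then have "subtower_of T x \<alpha> = {k \<in> T \<alpha>. (k \<in> A (level (T \<alpha>))) \<noteq> (k \<in> ?Z)}"
      by (auto simp: subtower_of_def bit_add_eq_1_iff w_def)
    moreover have "A \<alpha> \<subseteq> T \<alpha>" using A by (simp add: subtower_def)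
    ultimately have "sym_diff (?Z \<inter> T \<alpha>) (level_sym_diff A (subtower_of T x) \<alpha>)
        \<subseteq> T \<alpha> \<inter> sym_diff (A \<alpha>) (A (level (T \<alpha>)))"
      by (auto simp: level_sym_diff_def)
    moreover have "finite (T \<alpha> \<inter> sym_diff (A \<alpha>) (A (level (T \<alpha>))))"
      by (rule subtower_coherent_on_family[OF T A order_refl])
        (auto simp: level tower_family_level intro: subsetD[OF level(1)[OF tower_family_level]])
    ultimately show ?thesis unfolding almost_eq_def by (rule finite_subset)
  qed
  then have "\<not> gap_in T (level_sym_diff A (subtower_of T x))"
    unfolding gap_in_iff[OF T] by blast
  then show thesis using that x A sub by (simp add: cohomologous_def)
qed


section \<open>The isomorphism\<close>

theorem theorem14:
  fixes T :: "omega1 \<Rightarrow> nat set"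
  assumes "tower T"
  shows "group (gap_group T) \<and> cohomology_group (tower_family T) 1 \<cong> gap_group T"
proof
  note T = \<open>tower T\<close>
  show grp: "group (gap_group T)" using T by (rule group_gap_group)
  let ?\<D> = "tower_family T"
  let ?C = "cochain_group ?\<D> 1"
  let ?Z = "?C\<lparr>carrier := cocycles ?\<D> 1\<rparr>"
  let ?\<phi> = "\<lambda>x. cohomologous T `` {subtower_of T x}"
  note sub = subtower_subtower_of[OF T]
  interpret group_hom ?Z "gap_group T" ?\<phi>
  proof (rule group_hom.intro)
    show "group ?Z"
      by (rule subgroup.subgroup_is_group[OF subgroup_cocycles group_cochain_group])
    show "group_hom_axioms ?Z (gap_group T) ?\<phi>"
    proof (intro group_hom_axioms.intro homI)
      fix x y assume "x \<in> carrier ?Z" "y \<in> carrier ?Z"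
      then show "?\<phi> (x \<otimes>\<^bsub>?Z\<^esub> y) = ?\<phi> x \<otimes>\<^bsub>gap_group T\<^esub> ?\<phi> y"
        by (simp add: subtower_of_mult[OF T] mult_gap_group[OF T] sub)
    qed (simp add: carrier_gap_group[OF T] quotientI sub)
  qed (rule grp)
  have "kernel ?Z (gap_group T) ?\<phi> =
      {x \<in> cocycles ?\<D> 1. x \<in> coboundaries ?\<D> 1}"
    using class_eq_one_iff[OF T sub] subtower_of_trivial_iff[OF T] by (auto simp: kernel_def)
  also have "\<dots> = coboundaries ?\<D> 1" using coboundaries_1_subset by blast
  finally have ker: "kernel ?Z (gap_group T) ?\<phi> = coboundaries ?\<D> 1" .
  have "?\<phi> ` carrier ?Z = carrier (gap_group T)"
  proof
    show "carrier (gap_group T) \<subseteq> ?\<phi> ` carrier ?Z"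
    proof
      fix P assume "P \<in> carrier (gap_group T)"
      then obtain A where A: "subtower T A" and P: "P = cohomologous T `` {A}"
        by (auto simp: carrier_gap_group[OF T] quotient_def)
      obtain x where "x \<in> cocycles ?\<D> 1" "(A, subtower_of T x) \<in> cohomologous T"
        using ex_cocycle_cohomologous[OF T A] .
      then show "P \<in> ?\<phi> ` carrier ?Z"
        using equiv_class_eq[OF equiv_cohomologous[OF T]] P by auto
    qed
  qed (use hom_closed in blast)
  then show "cohomology_group ?\<D> 1 \<cong> gap_group T"
    using FactGroup_iso unfolding ker by (simp add: cohomology_group_def)
qed

end
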